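(* Let $k$ be a field, $X=\{x_1,\ldots,x_\mu\}$ a finite set of noncommuting variables, and $M$ a right $k\langle X\rangle$-module of dimension $n$ over $k$. Choose a basis of $M$ and let $A_i$, $i=1,\ldots,\mu$, be the $n\times n$ matrix over $k$ of the operator $x_i$ in this basis. Let $E_n$ be the $n\times n$ identity matrix, and regard $E_n-x_1A_1-\cdots-x_\mu A_\mu$ as an $n\times n$ matrix over $k\langle\langle X\rangle\rangle$. Then the sum of inverses of quasideterminants $$\sum_{i=1}^n \left|E_n-x_1A_1-\cdots-x_\mu A_\mu\right|_{ii}^{-1}$$ does not depend on the choice of the basis and is equal to the characteristic function $\chi_M$ of $M$.
   Context: $k\langle X\rangle$ is the free associative unital $k$-algebra (noncommutative polynomials) on $X$, and $k\langle\langle X\rangle\rangle$ is the $k$-algebra of noncommutative formal power series in $x_1,\ldots,x_\mu$. $X^*$ is the free monoid on $X$; its elements are called words. Characteristic function: for a right $k\langle X\rangle$-module $M$, finite-dimensional over $k$, let $u_i\in\mathrm{End}_k(M)$ be the endomorphism given by the action of $x_i$, and let $\alpha:k\langle X\rangle\to\mathrm{End}_k(M)$ be the $k$-algebra homomorphism with $\alpha(x_i)=u_i$ (endomorphisms are written on the right of their arguments, so $\alpha(x_{i_1}\cdots x_{i_p})$ means: apply $u_{i_1}$ first, then $u_{i_2}$, etc.). Matrices of operators are taken correspondingly, acting on the right on row vectors of coordinates, so that $\alpha(x_{i_1}\cdots x_{i_p})$ has matrix $A_{i_1}\cdots A_{i_p}$. Then $$\chi_M=\sum_{w\in X^*}\mathrm{Tr}(\alpha(w))\,w\in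 k\langle\langle X\rangle\rangle .$$ Quasideterminants: let $A=(a_{ij})$ be an $m\times m$ matrix over a (not necessarily commutative) algebra $R$. For $1\le i,j\le m$ let $r_i(A)$ and $c_j(A)$ be the $i$-th row and $j$-th column of $A$, and let $A^{ij}$ be the submatrix obtained by removing the $i$-th row and $j$-th column. For a row vector $r$ let $r^{(j)}$ be $r$ without its $j$-th entry; for a column vector $c$ let $c^{(i)}$ be $c$ without its $i$-th entry. If $A^{ij}$ is invertible, the quasideterminant $|A|_{ij}\in R$ is $$|A|_{ij}=a_{ij}-r_i(A)^{(j)}(A^{ij})^{-1}c_j(A)^{(i)}$$ (for $m=1$, $|A|_{11}=a_{11}$). *)

theory Defs
  imports "Jordan_Normal_Form.Determinant" "HOL-Library.Poly_Mapping"
begin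

section \<open>Words, noncommutative polynomials and power series\<close>

text \<open>The alphabet $X$ is a (finite) type, $X^*$ is the type of lists over it. Lists form a
  monoid under concatenation; it is written additively because that is how the convolution
  product of \<^theory>\<open>HOL-Library.Poly_Mapping\<close> expects its monoid of exponents.\<close>

instantiation list :: (type) monoid_add
begin

definition zero_list :: "'a list" where "zero_list = []"

definition plus_list :: "'a list \<Rightarrow> 'a list \<Rightarrow> 'a list" where "plus_list = (@)"

instance by standard (simp_all add: zero_list_def plus_list_def)

end

type_synonym ('x, 'k) ncpoly = "'x list \<Rightarrow>\<^sub>0 'k"

definition ncpoly_const :: "'k::zero \<Rightarrow> ('x, 'k) ncpoly" where
  "ncpoly_const c = Poly_Mapping.single [] c"

definition ncpoly_word :: "'x list \<Rightarrow> ('x, 'k::zero_neq_one) ncpoly" where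
  "ncpoly_word w = Poly_Mapping.single w 1"

definition ncpoly_var :: "'x \<Rightarrow> ('x, 'k::zero_neq_one) ncpoly" where
  "ncpoly_var x = ncpoly_word [x]"

lemma ncpoly_word_Nil: "ncpoly_word [] = (1 :: ('x, 'k::ring_1) ncpoly)"
  by (simp add: ncpoly_word_def zero_list_def flip: single_one)

lemma ncpoly_word_append:
  "ncpoly_word (u @ v) = (ncpoly_word u * ncpoly_word v :: ('x, 'k::ring_1) ncpoly)"
  by (simp add: ncpoly_word_def mult_single plus_list_def)

typedef ('x, 'k) ncfps = "UNIV :: ('x list \<Rightarrow> 'k) set"
  morphisms ncfps_coeff Abs_ncfps ..

lemma ncfps_coeff_Abs [simp]: "ncfps_coeff (Abs_ncfps f) = f"
  by (simp add: Abs_ncfps_inverse)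

lemma ncfps_eqI: "(\<And>w. ncfps_coeff f w = ncfps_coeff g w) \<Longrightarrow> f = g"
  by (metis ncfps_coeff_inverse ext)

text \<open>In the product, the decompositions $w = uv$ are enumerated by the length of $u$.\<close>

instantiation ncfps :: (type, ring_1) ring_1
begin

definition zero_ncfps :: "('a, 'b) ncfps" where
  "zero_ncfps = Abs_ncfps (\<lambda>w. 0)"

definition one_ncfps :: "('a, 'b) ncfps" where
  "one_ncfps = Abs_ncfps (\<lambda>w. if w = [] then 1 else 0)"

definition plus_ncfps :: "('a, 'b) ncfps \<Rightarrow> ('a, 'b) ncfps \<Rightarrow> ('a, 'b) ncfps" where
  "plus_ncfps f g = Abs_ncfps (\<lambda>w. ncfps_coeff f w + ncfps_coeff g w)"

definition minus_ncfps :: "('a, 'b) ncfps \<Rightarrow> ('a, 'b) ncfps \<Rightarrow> ('a, 'b) ncfps" where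
  "minus_ncfps f g = Abs_ncfps (\<lambda>w. ncfps_coeff f w - ncfps_coeff g w)"

definition uminus_ncfps :: "('a, 'b) ncfps \<Rightarrow> ('a, 'b) ncfps" where
  "uminus_ncfps f = Abs_ncfps (\<lambda>w. - ncfps_coeff f w)"

definition times_ncfps :: "('a, 'b) ncfps \<Rightarrow> ('a, 'b) ncfps \<Rightarrow> ('a, 'b) ncfps" where
  "times_ncfps f g =
     Abs_ncfps (\<lambda>w. \<Sum>i\<le>length w. ncfps_coeff f (take i w) * ncfps_coeff g (drop i w))"

lemma sum_triangle_swap:
  fixes F :: "nat \<Rightarrow> nat \<Rightarrow> nat \<Rightarrow> 'c::comm_monoid_add"
  shows "(\<Sum>j\<le>k. \<Sum>i\<le>j. F i (j - i) (n - j)) = (\<Sum>j\<le>k. \<Sum>i\<le>k - j. F j i (n - j - i))"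
  by (induct k) (simp_all add: Suc_diff_le sum.distrib add.assoc)

instance
proof
  fix f g h :: "('a, 'b) ncfps"
  show "f * g * h = f * (g * h)"
  proof (rule ncfps_eqI)
    fix w :: "'a list"
    let ?n = "length w"
    define F where "F i l r = ncfps_coeff f (take i w) *
      (ncfps_coeff g (take l (drop i w)) * ncfps_coeff h (drop (?n - r) w))" for i l r
    have "ncfps_coeff (f * g * h) w = (\<Sum>j\<le>?n. \<Sum>i\<le>j. F i (j - i) (?n - j))"
      unfolding times_ncfps_def F_def
      by (auto simp: sum_distrib_right mult.assoc drop_take min_def intro!: sum.cong)
    also have "\<dots> = (\<Sum>j\<le>?n. \<Sum>i\<le>?n - j. F j i (?n - j - i))"
      by (rule sum_triangle_swap)
    also have "\<dots> = ncfps_coeff (f * (g * h)) w"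
      unfolding times_ncfps_def F_def
      by (auto simp: sum_distrib_left add.commute intro!: sum.cong)
    finally show "ncfps_coeff (f * g * h) w = ncfps_coeff (f * (g * h)) w" .
  qed
  show "1 * f = f"
  proof (rule ncfps_eqI)
    fix w :: "'a list"
    have "ncfps_coeff (1 * f) w =
        (\<Sum>i\<le>length w. if i = 0 then ncfps_coeff f w else 0)"
      unfolding times_ncfps_def one_ncfps_def ncfps_coeff_Abs by (rule sum.cong) auto
    then show "ncfps_coeff (1 * f) w = ncfps_coeff f w" by simp
  qed
  show "f * 1 = f"
  proof (rule ncfps_eqI)
    fix w :: "'a list"
    have "ncfps_coeff (f * 1) w =
        (\<Sum>i\<le>length w. if i = length w then ncfps_coeff f w else 0)"
      unfolding times_ncfps_def one_ncfps_def ncfps_coeff_Abs by (rule sum.cong) auto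
    then show "ncfps_coeff (f * 1) w = ncfps_coeff f w" by simp
  qed
  show "(f + g) * h = f * h + g * h"
    by (simp add: times_ncfps_def plus_ncfps_def distrib_right sum.distrib)
  show "f * (g + h) = f * g + f * h"
    by (simp add: times_ncfps_def plus_ncfps_def distrib_left sum.distrib)
  show "(0::('a, 'b) ncfps) \<noteq> 1"
  proof
    assume "(0::('a, 'b) ncfps) = 1"
    then have "ncfps_coeff (0::('a, 'b) ncfps) [] = ncfps_coeff 1 []" by simp
    then show False by (simp add: zero_ncfps_def one_ncfps_def)
  qed
qed (auto intro!: ncfps_eqI
      simp: plus_ncfps_def zero_ncfps_def uminus_ncfps_def minus_ncfps_def add.assoc add.commute)

end

definition ncfps_of_ncpoly :: "('x, 'k::zero) ncpoly \<Rightarrow> ('x, 'k) ncfps" where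
  "ncfps_of_ncpoly p = Abs_ncfps (Poly_Mapping.lookup p)"


section \<open>Inverses and quasideterminants over a noncommutative ring\<close>

definition ring_invertible :: "'a::ring_1 \<Rightarrow> bool" where
  "ring_invertible a \<longleftrightarrow> (\<exists>b. a * b = 1 \<and> b * a = 1)"

definition ring_inverse :: "'a::ring_1 \<Rightarrow> 'a" where
  "ring_inverse a = (THE b. a * b = 1 \<and> b * a = 1)"

definition mat_inverse :: "'a::ring_1 mat \<Rightarrow> 'a mat" where
  "mat_inverse A = (THE B. inverts_mat A B \<and> inverts_mat B A)"

definition vec_delete :: "'a vec \<Rightarrow> nat \<Rightarrow> 'a vec" where
  "vec_delete v j = vec (dim_vec v - 1) (\<lambda>i. v $ (if i < j then i else Suc i))"

text \<open>Rows and columns are numbered from 0. The value is only meaningful if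
  \<^term>\<open>mat_delete A i j\<close> is invertible. For a $1 \times 1$ matrix that submatrix is the
  (invertible) $0 \times 0$ matrix and the subtracted term is an empty sum.\<close>

definition quasidet :: "'a::ring_1 mat \<Rightarrow> nat \<Rightarrow> nat \<Rightarrow> 'a" where
  "quasidet A i j = A $$ (i, j) -
     vec_delete (row A i) j \<bullet>
       (mat_inverse (mat_delete A i j) *\<^sub>v vec_delete (col A j) i)"


section \<open>Modules over the free algebra and their characteristic functions\<close>

locale right_module =
  fixes act :: "'m::ab_group_add \<Rightarrow> 'r::ring_1 \<Rightarrow> 'm"  (infixl \<open>\<triangleleft>\<close> 75)
  assumes act_add_left: "(u + v) \<triangleleft> a = u \<triangleleft> a + v \<triangleleft> a"
    and act_add_right: "v \<triangleleft> (a + b) = v \<triangleleft> a + v \<triangleleft> b"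
    and act_mult: "v \<triangleleft> (a * b) = v \<triangleleft> a \<triangleleft> b"
    and act_one: "v \<triangleleft> 1 = v"

locale free_algebra_module = right_module act
  for act :: "'m::ab_group_add \<Rightarrow> ('x::finite, 'k::field) ncpoly \<Rightarrow> 'm"  (infixl \<open>\<triangleleft>\<close> 75)
begin

text \<open>The $k$-vector space structure of the module is the restriction of the action to constants.\<close>

definition scale :: "'k \<Rightarrow> 'm \<Rightarrow> 'm" where
  "scale c v = v \<triangleleft> ncpoly_const c"

sublocale VS: Vector_Spaces.vector_space scale
proof
  fix a b :: 'k and u v :: 'm
  show "scale a (u + v) = scale a u + scale a v"
    by (simp add: scale_def act_add_left)
  show "scale (a + b) v = scale a v + scale b v"
    by (simp add: scale_def ncpoly_const_def single_add act_add_right)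
  have "ncpoly_const (a * b) = (ncpoly_const b * ncpoly_const a :: ('x, 'k) ncpoly)"
    by (simp add: ncpoly_const_def mult_single plus_list_def mult.commute)
  then show "scale a (scale b v) = scale (a * b) v"
    by (simp add: scale_def act_mult)
  have "ncpoly_const 1 = (1 :: ('x, 'k) ncpoly)"
    by (simp add: ncpoly_const_def zero_list_def flip: single_one)
  then show "scale 1 v = v"
    by (simp add: scale_def act_one)
qed

definition ordered_basis :: "'m list \<Rightarrow> bool" where
  "ordered_basis bs \<longleftrightarrow> distinct bs \<and> VS.independent (set bs) \<and> VS.span (set bs) = UNIV"

text \<open>Matrices act from the right on row vectors of coordinates, so row \<open>p\<close> holds the
  coordinates of the image of the \<open>p\<close>-th basis vector.\<close>

definition op_matrix :: "'m list \<Rightarrow> ('m \<Rightarrow> 'm) \<Rightarrow> 'k mat" where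
  "op_matrix bs u = mat (length bs) (length bs)
     (\<lambda>(p, q). VS.representation (set bs) (u (bs ! p)) (bs ! q))"

text \<open>The trace of an endomorphism is computed in one arbitrarily chosen basis.\<close>

definition op_trace :: "('m \<Rightarrow> 'm) \<Rightarrow> 'k" where
  "op_trace u = (let bs = (SOME bs. ordered_basis bs)
                 in \<Sum>i<length bs. op_matrix bs u $$ (i, i))"

text \<open>The homomorphism $\alpha$ from $k\langle X\rangle$ to $\mathrm{End}_k(M)$, endomorphisms
  being composed from left to right.\<close>

definition alpha :: "('x, 'k) ncpoly \<Rightarrow> 'm \<Rightarrow> 'm" where
  "alpha p = (\<lambda>v. v \<triangleleft> p)"

definition char_fun :: "('x, 'k) ncfps" where
  "char_fun = Abs_ncfps (\<lambda>w. op_trace (alpha (ncpoly_word w)))"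

definition var_matrix :: "'m list \<Rightarrow> 'x \<Rightarrow> 'k mat" where
  "var_matrix bs x = op_matrix bs (alpha (ncpoly_var x))"

text \<open>$E_n - x_1 A_1 - \cdots - x_\mu A_\mu$ over $k\langle\langle X\rangle\rangle$.\<close>

definition pencil :: "'m list \<Rightarrow> ('x, 'k) ncfps mat" where
  "pencil bs = map_mat ncfps_of_ncpoly
     (1\<^sub>m (length bs) - mat (length bs) (length bs)
        (\<lambda>(p, q). \<Sum>x\<in>UNIV. ncpoly_var x * ncpoly_const (var_matrix bs x $$ (p, q))))"

end

end

(* Over power series, E_n - sum_x x C_x has the two-sided inverse with (p, q) entry
   sum_w (C_w)_pq w, where C_w is the product of the C_x along the word w. The submatrix without
   row and column i is again of this form, hence invertible, and block elimination identifies the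
   inverse of the i-th diagonal quasideterminant with the (i, i) entry of the inverse. Summing over
   i, the coefficient of w is the trace of C_w, the matrix of the operator alpha(w). *)

theory Submission
  imports Defs
begin

section \<open>Uniqueness of two-sided inverses of ring elements and matrices\<close>

lemma ring_inverse_eqI:
  assumes "a * b = 1" "b * a = 1"
  shows "ring_inverse a = b"
  unfolding ring_inverse_def
proof (rule the_equality)
  show "a * b = 1 \<and> b * a = 1" using assms by simp
next
  fix c assume "a * c = 1 \<and> c * a = 1"
  then show "c = b" by (metis assms(2) mult.assoc mult_1_left mult_1_right)
qed

lemma invertible_matI:
  assumes "A \<in> carrier_mat n n" "B \<in> carrier_mat n n" "A * B = 1\<^sub>m n" "B * A = 1\<^sub>m n"
  shows "invertible_mat A"
  using assms by (auto simp: invertible_mat_def inverts_mat_def square_mat.simps)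

lemma mat_inverse_eqI:
  assumes A: "A \<in> carrier_mat n n" and B: "B \<in> carrier_mat n n"
    and AB: "A * B = 1\<^sub>m n" and BA: "B * A = 1\<^sub>m n"
  shows "mat_inverse A = B"
  unfolding mat_inverse_def
proof (rule the_equality)
  show "inverts_mat A B \<and> inverts_mat B A" using assms by (auto simp: inverts_mat_def)
next
  fix C assume "inverts_mat A C \<and> inverts_mat C A"
  then have AC: "A * C = 1\<^sub>m n" and CA: "C * A = 1\<^sub>m (dim_row C)"
    using A by (auto simp: inverts_mat_def)
  \<comment> \<open>The description in \<open>mat_inverse\<close> ranges over matrices of every
    size, so the size of the competitor \<open>C\<close> has to be recovered first, by counting the
    columns in both product equations.\<close>
  have "dim_col C = n" using arg_cong[OF AC, of dim_col] by simp
  moreover have "dim_row C = n" using arg_cong[OF CA, of dim_col] A by simp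
  ultimately have C: "C \<in> carrier_mat n n" by auto
  have "C = (B * A) * C" using BA C by simp
  also have "\<dots> = B" using A B C AC by (simp add: assoc_mult_mat[OF B A C])
  finally show "C = B" .
qed

lemma mat_times_index_sum:
  assumes "A \<in> carrier_mat n m" "B \<in> carrier_mat m l" "i < n" "j < l"
  shows "(A * B) $$ (i, j) = (\<Sum>k<m. A $$ (i, k) * B $$ (k, j))"
  using assms by (auto simp: scalar_prod_def lessThan_atLeast0 intro!: sum.cong)

section \<open>Splitting off one index, and block elimination for quasideterminants\<close>

lemma insert_index_less: "k < n - 1 \<Longrightarrow> insert_index i k < n"
  by (auto simp: insert_index_def)

lemma insert_index_neq: "insert_index i k \<noteq> i"
  by (auto simp: insert_index_def)

lemma insert_index_image:
  assumes "i < n"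
  shows "insert_index i ` {..<n - 1} = {..<n} - {i}"
proof
  show "insert_index i ` {..<n - 1} \<subseteq> {..<n} - {i}"
    using assms by (auto simp: insert_index_def)
  show "{..<n} - {i} \<subseteq> insert_index i ` {..<n - 1}"
  proof
    fix k assume k: "k \<in> {..<n} - {i}"
    then have "k = insert_index i (delete_index i k)" and "delete_index i k < n - 1"
      using assms by (auto simp: delete_index_def insert_index_def)
    then show "k \<in> insert_index i ` {..<n - 1}" by blast
  qed
qed

text \<open>For \<open>k\<close> below \<open>n - 1\<close>, \<open>insert_index i k\<close> runs
  exactly once through the indices other than \<open>i\<close>, in the numbering used by
  \<open>mat_delete\<close>. In this form a matrix product splits into blocks.\<close>

lemma sum_insert_index:
  assumes "i < n"
  shows "(\<Sum>k<n. f k) = f i + (\<Sum>k<n - 1. f (insert_index i k))"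
proof -
  have "(\<Sum>k<n. f k) = f i + sum f ({..<n} - {i})"
    using assms by (simp add: sum.remove)
  also have "sum f ({..<n} - {i}) = (\<Sum>k<n - 1. f (insert_index i k))"
    unfolding insert_index_image[OF assms, symmetric]
    by (subst sum.reindex) (auto simp: insert_index_inj_on)
  finally show ?thesis .
qed

lemma mat_delete_insert_index:
  assumes "A \<in> carrier_mat n n" "k < n - 1" "l < n - 1"
  shows "mat_delete A i j $$ (k, l) = A $$ (insert_index i k, insert_index j l)"
  using assms by (auto simp: mat_delete_def insert_index_def)

text \<open>The index shift inside \<open>vec_delete\<close> is \<open>insert_index\<close>, so the
  product of row, inverse and column becomes a double sum. The three factors keep their order, since
  the ring need not be commutative.\<close>

lemma quasidet_sum:
  assumes A: "A \<in> carrier_mat n n" and i: "i < n"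
    and D: "D \<in> carrier_mat (n - 1) (n - 1)" and "mat_inverse (mat_delete A i i) = D"
  shows "quasidet A i i = A $$ (i, i) - (\<Sum>k<n - 1. \<Sum>l<n - 1.
    A $$ (i, insert_index i k) * (D $$ (k, l) * A $$ (insert_index i l, i)))"
  unfolding quasidet_def assms(4) scalar_prod_def
  using A D i
  by (auto simp: vec_delete_def lessThan_atLeast0 scalar_prod_def sum_distrib_left
      insert_index_def[abs_def] if_distrib[of "\<lambda>x. _ $$ x"] intro!: sum.cong)

text \<open>Block elimination in \<open>A B = B A = 1\<close>: the off-diagonal blocks of these two equations
  express the deleted column and row of \<open>B\<close> through its entry at \<open>(i, i)\<close>.\<close>

lemma quasidet_inverse_entry:
  fixes A :: "'a::ring_1 mat"
  assumes A: "A \<in> carrier_mat n n" and B: "B \<in> carrier_mat n n" and i: "i < n"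
    and AB: "A * B = 1\<^sub>m n" and BA: "B * A = 1\<^sub>m n"
    and D: "D \<in> carrier_mat (n - 1) (n - 1)"
    and AD: "mat_delete A i i * D = 1\<^sub>m (n - 1)" and DA: "D * mat_delete A i i = 1\<^sub>m (n - 1)"
  shows "quasidet A i i * B $$ (i, i) = 1" "B $$ (i, i) * quasidet A i i = 1"
proof -
  \<comment> \<open>Keeps \<open>n - 1\<close> from being rewritten to \<open>n - Suc 0\<close>, so
    that sizes and index ranges stay in the form used by the earlier facts.\<close>
  note One_nat_def [simp del]
  let ?s = "insert_index i"
  let ?N = "{..<n - 1}"
  have A': "mat_delete A i i \<in> carrier_mat (n - 1) (n - 1)"
    using mat_delete_carrier[OF A] .
  have Q: "quasidet A i i = A $$ (i, i) -
      (\<Sum>k\<in>?N. \<Sum>l\<in>?N. A $$ (i, ?s k) * (D $$ (k, l) * A $$ (?s l, i)))"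
    using quasidet_sum[OF A i D mat_inverse_eqI[OF A' D AD DA]] .
  have DA_entry: "(\<Sum>l\<in>?N. D $$ (k, l) * A $$ (?s l, ?s m)) = (if k = m then 1 else 0)"
    if "k < n - 1" "m < n - 1" for k m
    using arg_cong[OF DA, of "\<lambda>M. M $$ (k, m)"] that
    by (simp add: mat_times_index_sum[OF D A' that] mat_delete_insert_index[OF A])
  have AD_entry: "(\<Sum>l\<in>?N. A $$ (?s k, ?s l) * D $$ (l, m)) = (if k = m then 1 else 0)"
    if "k < n - 1" "m < n - 1" for k m
    using arg_cong[OF AD, of "\<lambda>M. M $$ (k, m)"] that
    by (simp add: mat_times_index_sum[OF A' D that] mat_delete_insert_index[OF A])
  have AB_entry: "A $$ (p, i) * B $$ (i, q) + (\<Sum>k\<in>?N. A $$ (p, ?s k) * B $$ (?s k, q))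
      = (if p = q then 1 else 0)" if "p < n" "q < n" for p q
    using arg_cong[OF AB, of "\<lambda>M. M $$ (p, q)"] that
    by (simp add: mat_times_index_sum[OF A B that] sum_insert_index[OF i])
  have BA_entry: "B $$ (p, i) * A $$ (i, q) + (\<Sum>k\<in>?N. B $$ (p, ?s k) * A $$ (?s k, q))
      = (if p = q then 1 else 0)" if "p < n" "q < n" for p q
    using arg_cong[OF BA, of "\<lambda>M. M $$ (p, q)"] that
    by (simp add: mat_times_index_sum[OF B A that] sum_insert_index[OF i])
  \<comment> \<open>Column \<open>i\<close> of \<open>A * B = 1\<close>, read in the rows other than
    \<open>i\<close>, has right-hand side 0. Multiplying by \<open>D\<close> on the left cancels the
    submatrix.\<close>
  have col: "(\<Sum>l\<in>?N. D $$ (k, l) * A $$ (?s l, i)) * B $$ (i, i) = - B $$ (?s k, i)"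
    if k: "k < n - 1" for k
  proof -
    have "(\<Sum>l\<in>?N. D $$ (k, l) * A $$ (?s l, i)) * B $$ (i, i)
        = (\<Sum>l\<in>?N. D $$ (k, l) * (- (\<Sum>m\<in>?N. A $$ (?s l, ?s m) * B $$ (?s m, i))))"
      unfolding sum_distrib_right
    proof (rule sum.cong[OF refl])
      fix l assume "l \<in> ?N"
      then have "A $$ (?s l, i) * B $$ (i, i)
          + (\<Sum>m\<in>?N. A $$ (?s l, ?s m) * B $$ (?s m, i)) = 0"
        using AB_entry[of "?s l" i] i by (auto simp: insert_index_less insert_index_neq)
      then have "A $$ (?s l, i) * B $$ (i, i)
          = - (\<Sum>m\<in>?N. A $$ (?s l, ?s m) * B $$ (?s m, i))"
        by (simp add: eq_neg_iff_add_eq_0)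
      then show "D $$ (k, l) * A $$ (?s l, i) * B $$ (i, i)
          = D $$ (k, l) * (- (\<Sum>m\<in>?N. A $$ (?s l, ?s m) * B $$ (?s m, i)))"
        by (simp add: mult.assoc)
    qed
    also have "\<dots> = - (\<Sum>l\<in>?N. \<Sum>m\<in>?N. D $$ (k, l) * A $$ (?s l, ?s m) * B $$ (?s m, i))"
      by (simp add: sum_distrib_left sum_negf mult.assoc)
    also have "\<dots> = - (\<Sum>m\<in>?N. (\<Sum>l\<in>?N. D $$ (k, l) * A $$ (?s l, ?s m)) * B $$ (?s m, i))"
      by (subst sum.swap) (simp add: sum_distrib_right)
    also have "\<dots> = - (\<Sum>m\<in>?N. if k = m then B $$ (?s m, i) else 0)"
      using k by (intro arg_cong[of _ _ uminus] sum.cong) (auto simp: DA_entry)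
    also have "\<dots> = - B $$ (?s k, i)" using k by simp
    finally show ?thesis .
  qed
  \<comment> \<open>The mirror image: row \<open>i\<close> of \<open>B * A = 1\<close>, read in the
    columns other than \<open>i\<close>, with \<open>D\<close> multiplied from the right.\<close>
  have row: "B $$ (i, i) * (\<Sum>k\<in>?N. A $$ (i, ?s k) * D $$ (k, l)) = - B $$ (i, ?s l)"
    if l: "l < n - 1" for l
  proof -
    have "B $$ (i, i) * (\<Sum>k\<in>?N. A $$ (i, ?s k) * D $$ (k, l))
        = (\<Sum>k\<in>?N. (- (\<Sum>m\<in>?N. B $$ (i, ?s m) * A $$ (?s m, ?s k))) * D $$ (k, l))"
      unfolding sum_distrib_left
    proof (rule sum.cong[OF refl])
      fix k assume "k \<in> ?N"
      then have "B $$ (i, i) * A $$ (i, ?s k)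
          + (\<Sum>m\<in>?N. B $$ (i, ?s m) * A $$ (?s m, ?s k)) = 0"
        using BA_entry[of i "?s k"] i by (auto simp: insert_index_less insert_index_neq[THEN not_sym])
      then have "B $$ (i, i) * A $$ (i, ?s k)
          = - (\<Sum>m\<in>?N. B $$ (i, ?s m) * A $$ (?s m, ?s k))"
        by (simp add: eq_neg_iff_add_eq_0)
      then show "B $$ (i, i) * (A $$ (i, ?s k) * D $$ (k, l))
          = (- (\<Sum>m\<in>?N. B $$ (i, ?s m) * A $$ (?s m, ?s k))) * D $$ (k, l)"
        by (simp flip: mult.assoc)
    qed
    also have "\<dots> = - (\<Sum>k\<in>?N. \<Sum>m\<in>?N. B $$ (i, ?s m) * (A $$ (?s m, ?s k) * D $$ (k, l)))"
      by (simp add: sum_distrib_right sum_negf mult.assoc)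
    also have "\<dots> = - (\<Sum>m\<in>?N. B $$ (i, ?s m) * (\<Sum>k\<in>?N. A $$ (?s m, ?s k) * D $$ (k, l)))"
      by (subst sum.swap) (simp add: sum_distrib_left)
    also have "\<dots> = - (\<Sum>m\<in>?N. if m = l then B $$ (i, ?s m) else 0)"
      using l by (intro arg_cong[of _ _ uminus] sum.cong) (auto simp: AD_entry)
    also have "\<dots> = - B $$ (i, ?s l)" using l by simp
    finally show ?thesis .
  qed
  \<comment> \<open>By \<open>col\<close>, the subtracted double sum turns into the missing terms of
    the \<open>(i, i)\<close> entry of \<open>A * B\<close>.\<close>
  have "quasidet A i i * B $$ (i, i) = A $$ (i, i) * B $$ (i, i)
      - (\<Sum>k\<in>?N. A $$ (i, ?s k) * ((\<Sum>l\<in>?N. D $$ (k, l) * A $$ (?s l, i)) * B $$ (i, i)))"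
    by (simp add: Q left_diff_distrib sum_distrib_left sum_distrib_right mult.assoc)
  also have "\<dots> = A $$ (i, i) * B $$ (i, i) + (\<Sum>k\<in>?N. A $$ (i, ?s k) * B $$ (?s k, i))"
    by (simp add: col sum_negf)
  finally show "quasidet A i i * B $$ (i, i) = 1" using AB_entry[of i i] i by simp
  \<comment> \<open>Here the order of summation is exchanged first, so that the inner sum runs over
    \<open>k\<close> as in \<open>row\<close>; what results is the \<open>(i, i)\<close> entry of
    \<open>B * A\<close>.\<close>
  have "B $$ (i, i) * quasidet A i i = B $$ (i, i) * A $$ (i, i)
      - B $$ (i, i) * (\<Sum>l\<in>?N. \<Sum>k\<in>?N. A $$ (i, ?s k) * D $$ (k, l) * A $$ (?s l, i))"
    unfolding Q by (subst sum.swap) (simp add: right_diff_distrib mult.assoc)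
  also have "\<dots> = B $$ (i, i) * A $$ (i, i)
      - (\<Sum>l\<in>?N. B $$ (i, i) * (\<Sum>k\<in>?N. A $$ (i, ?s k) * D $$ (k, l)) * A $$ (?s l, i))"
    by (simp add: sum_distrib_left sum_distrib_right mult.assoc)
  also have "\<dots> = B $$ (i, i) * A $$ (i, i) + (\<Sum>l\<in>?N. B $$ (i, ?s l) * A $$ (?s l, i))"
    by (simp add: row sum_negf)
  finally show "B $$ (i, i) * quasidet A i i = 1" using BA_entry[of i i] i by simp
qed

section \<open>Coefficients of products of power series with a factor of degree at most one\<close>

lemma ncfps_coeff_zero [simp]: "ncfps_coeff 0 w = 0"
  by (simp add: zero_ncfps_def)

lemma ncfps_coeff_one: "ncfps_coeff 1 w = (if w = [] then 1 else 0)"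
  by (simp add: one_ncfps_def)

lemma ncfps_coeff_sum: "ncfps_coeff (\<Sum>a\<in>S. f a) w = (\<Sum>a\<in>S. ncfps_coeff (f a) w)"
  by (induction S rule: infinite_finite_induct) (simp_all add: plus_ncfps_def)

text \<open>If the left factor vanishes on words longer than one letter, only the cuts after zero
  and after one letter contribute to the convolution.\<close>

lemma ncfps_coeff_affine_mult:
  assumes "\<And>w. length w > 1 \<Longrightarrow> ncfps_coeff f w = 0"
  shows "ncfps_coeff (f * g) [] = ncfps_coeff f [] * ncfps_coeff g []"
    and "ncfps_coeff (f * g) (x # w)
      = ncfps_coeff f [] * ncfps_coeff g (x # w) + ncfps_coeff f [x] * ncfps_coeff g w"
proof -
  show "ncfps_coeff (f * g) [] = ncfps_coeff f [] * ncfps_coeff g []"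
    by (simp add: times_ncfps_def)
  have "ncfps_coeff (f * g) (x # w)
      = (\<Sum>i\<le>Suc (length w). ncfps_coeff f (take i (x # w)) * ncfps_coeff g (drop i (x # w)))"
    by (simp add: times_ncfps_def)
  also have "\<dots> = (\<Sum>i\<in>{0, 1}. ncfps_coeff f (take i (x # w)) * ncfps_coeff g (drop i (x # w)))"
  proof (rule sum.mono_neutral_right; (intro ballI)?)
    fix i assume "i \<in> {..Suc (length w)} - {0, 1}"
    then show "ncfps_coeff f (take i (x # w)) * ncfps_coeff g (drop i (x # w)) = 0"
      using assms[of "take i (x # w)"] by (auto simp: min_def)
  qed auto
  finally show "ncfps_coeff (f * g) (x # w)
      = ncfps_coeff f [] * ncfps_coeff g (x # w) + ncfps_coeff f [x] * ncfps_coeff g w"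
    by simp
qed

text \<open>With the short factor on the right, the surviving cuts are those at the end of the word
  and before its last letter; hence the form \<open>w @ [x]\<close>.\<close>

lemma ncfps_coeff_mult_affine:
  assumes "\<And>w. length w > 1 \<Longrightarrow> ncfps_coeff f w = 0"
  shows "ncfps_coeff (g * f) [] = ncfps_coeff g [] * ncfps_coeff f []"
    and "ncfps_coeff (g * f) (w @ [x])
      = ncfps_coeff g (w @ [x]) * ncfps_coeff f [] + ncfps_coeff g w * ncfps_coeff f [x]"
proof -
  show "ncfps_coeff (g * f) [] = ncfps_coeff g [] * ncfps_coeff f []"
    by (simp add: times_ncfps_def)
  have "ncfps_coeff (g * f) (w @ [x]) = (\<Sum>i\<le>Suc (length w).
      ncfps_coeff g (take i (w @ [x])) * ncfps_coeff f (drop i (w @ [x])))"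
    by (simp add: times_ncfps_def)
  also have "\<dots> = (\<Sum>i\<in>{length w, Suc (length w)}.
      ncfps_coeff g (take i (w @ [x])) * ncfps_coeff f (drop i (w @ [x])))"
  proof (rule sum.mono_neutral_right; (intro ballI)?)
    fix i assume "i \<in> {..Suc (length w)} - {length w, Suc (length w)}"
    then show "ncfps_coeff g (take i (w @ [x])) * ncfps_coeff f (drop i (w @ [x])) = 0"
      using assms[of "drop i (w @ [x])"] by auto
  qed auto
  finally show "ncfps_coeff (g * f) (w @ [x])
      = ncfps_coeff g (w @ [x]) * ncfps_coeff f [] + ncfps_coeff g w * ncfps_coeff f [x]"
    by (simp add: add.commute)
qed

section \<open>Linear matrix pencils and their inverses over power series\<close>

definition lin_pencil :: "nat \<Rightarrow> ('x::finite \<Rightarrow> 'k::ring_1 mat) \<Rightarrow> ('x, 'k) ncfps mat" where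
  "lin_pencil n C = map_mat ncfps_of_ncpoly
     (1\<^sub>m n - mat n n (\<lambda>(p, q). \<Sum>x\<in>UNIV. ncpoly_var x * ncpoly_const (C x $$ (p, q))))"

definition word_mat :: "nat \<Rightarrow> ('x \<Rightarrow> 'k::ring_1 mat) \<Rightarrow> 'x list \<Rightarrow> 'k mat" where
  "word_mat n C w = foldr (\<lambda>x M. C x * M) w (1\<^sub>m n)"

text \<open>The geometric series of the matrix \<open>sum_x x C_x\<close>, collected by words: its
  power of exponent \<open>m\<close> supplies the words of length \<open>m\<close>.\<close>

definition word_series :: "nat \<Rightarrow> ('x \<Rightarrow> 'k::ring_1 mat) \<Rightarrow> ('x, 'k) ncfps mat" where
  "word_series n C = mat n n (\<lambda>(p, q). Abs_ncfps (\<lambda>w. word_mat n C w $$ (p, q)))"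

lemma lin_pencil_carrier [simp]: "lin_pencil n C \<in> carrier_mat n n"
  by (rule carrier_matI) (simp_all add: lin_pencil_def)

lemma word_series_carrier [simp]: "word_series n C \<in> carrier_mat n n"
  by (simp add: word_series_def)

lemma ncfps_coeff_word_series:
  "p < n \<Longrightarrow> q < n \<Longrightarrow> ncfps_coeff (word_series n C $$ (p, q)) w = word_mat n C w $$ (p, q)"
  by (simp add: word_series_def)

lemma word_mat_Nil [simp]: "word_mat n C [] = 1\<^sub>m n"
  and word_mat_Cons [simp]: "word_mat n C (x # w) = C x * word_mat n C w"
  by (simp_all add: word_mat_def)

lemma word_mat_carrier:
  assumes "\<And>x. C x \<in> carrier_mat n n"
  shows "word_mat n C w \<in> carrier_mat n n"
  by (induction w) (simp_all add: mult_carrier_mat[OF assms])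

text \<open>\<open>word_mat\<close> is defined by recursion on the first letter; multiplying by the
  pencil from the right requires splitting off the last one, which associativity permits.\<close>

lemma word_mat_snoc:
  assumes "\<And>x. C x \<in> carrier_mat n n"
  shows "word_mat n C (w @ [x]) = word_mat n C w * C x"
proof (induction w)
  case Nil
  show ?case using assms[of x] by simp
next
  case (Cons y w)
  then show ?case
    by (simp add: assoc_mult_mat[OF assms word_mat_carrier[OF assms] assms])
qed

text \<open>Each product of a variable and a constant is the single monomial
  \<open>Poly_Mapping.single [x] c\<close>, so all entries have degree at most one and the product
  formulas for such factors apply.\<close>

lemma ncfps_coeff_lin_pencil:
  fixes C :: "'x::finite \<Rightarrow> 'k::ring_1 mat"
  assumes "p < n" "q < n"
  shows "ncfps_coeff (lin_pencil n C $$ (p, q)) w =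
    (case w of [] \<Rightarrow> if p = q then 1 else 0 | [x] \<Rightarrow> - (C x $$ (p, q)) | _ \<Rightarrow> 0)"
proof -
  have "ncpoly_var x * ncpoly_const c = Poly_Mapping.single [x] c" for x :: 'x and c :: 'k
    by (simp add: ncpoly_var_def ncpoly_word_def ncpoly_const_def mult_single plus_list_def)
  then show ?thesis
    using assms
    by (auto simp: lin_pencil_def ncfps_of_ncpoly_def lookup_minus lookup_sum lookup_single
        lookup_one zero_list_def when_def split: list.split)
qed

text \<open>At a word \<open>w = x # v\<close> the identity contributes \<open>C_w\<close> and the
  letter \<open>x\<close> contributes \<open>- C_x C_v\<close>; these cancel by the recursion of
  \<open>word_mat\<close>. Only the empty word survives.\<close>

lemma lin_pencil_mult_word_series:
  fixes C :: "'x::finite \<Rightarrow> 'k::ring_1 mat"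
  assumes C: "\<And>x. C x \<in> carrier_mat n n"
  shows "lin_pencil n C * word_series n C = 1\<^sub>m n"
proof (rule eq_matI)
  fix p q assume "p < dim_row (1\<^sub>m n :: ('x, 'k) ncfps mat)" "q < dim_col (1\<^sub>m n :: ('x, 'k) ncfps mat)"
  then have p: "p < n" and q: "q < n" by simp_all
  have "ncfps_coeff ((lin_pencil n C * word_series n C) $$ (p, q)) w
      = ncfps_coeff (1\<^sub>m n $$ (p, q)) w" for w
  proof -
    have aff: "ncfps_coeff (lin_pencil n C $$ (p, r)) v = 0" if "r < n" "length v > 1" for r v
      using that p by (auto simp: ncfps_coeff_lin_pencil split: list.split)
    have eq: "ncfps_coeff ((lin_pencil n C * word_series n C) $$ (p, q)) w
        = (\<Sum>r<n. ncfps_coeff (lin_pencil n C $$ (p, r) * word_series n C $$ (r, q)) w)"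
      by (simp add: mat_times_index_sum[OF lin_pencil_carrier word_series_carrier p q]
          ncfps_coeff_sum)
    show ?thesis
    proof (cases w)
      case Nil
      have "ncfps_coeff ((lin_pencil n C * word_series n C) $$ (p, q)) w
          = (\<Sum>r<n. if p = r then word_mat n C [] $$ (r, q) else 0)"
        unfolding eq unfolding Nil using p q
        by (intro sum.cong) (auto simp: ncfps_coeff_affine_mult(1)[OF aff]
            ncfps_coeff_lin_pencil ncfps_coeff_word_series)
      then show ?thesis using p q Nil by (simp add: ncfps_coeff_one)
    next
      case (Cons x v)
      have "ncfps_coeff ((lin_pencil n C * word_series n C) $$ (p, q)) w
          = (\<Sum>r<n. (if p = r then word_mat n C w $$ (r, q) else 0)
              - C x $$ (p, r) * word_mat n C v $$ (r, q))"
        unfolding eq unfolding Cons using p q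
        by (intro sum.cong) (auto simp: ncfps_coeff_affine_mult(2)[OF aff]
            ncfps_coeff_lin_pencil ncfps_coeff_word_series)
      also have "\<dots> = word_mat n C w $$ (p, q) - (C x * word_mat n C v) $$ (p, q)"
        using p by (simp add: sum_subtractf mat_times_index_sum[OF C word_mat_carrier[OF C] p q])
      finally show ?thesis using p q Cons by (simp add: ncfps_coeff_one)
    qed
  qed
  then show "(lin_pencil n C * word_series n C) $$ (p, q) = 1\<^sub>m n $$ (p, q)"
    by (rule ncfps_eqI)
qed (simp_all add: lin_pencil_def word_series_def)

text \<open>The same cancellation at the last letter of the word, now through
  \<open>word_mat_snoc\<close>.\<close>

lemma word_series_mult_lin_pencil:
  fixes C :: "'x::finite \<Rightarrow> 'k::ring_1 mat"
  assumes C: "\<And>x. C x \<in> carrier_mat n n"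
  shows "word_series n C * lin_pencil n C = 1\<^sub>m n"
proof (rule eq_matI)
  fix p q assume "p < dim_row (1\<^sub>m n :: ('x, 'k) ncfps mat)" "q < dim_col (1\<^sub>m n :: ('x, 'k) ncfps mat)"
  then have p: "p < n" and q: "q < n" by simp_all
  have "ncfps_coeff ((word_series n C * lin_pencil n C) $$ (p, q)) w
      = ncfps_coeff (1\<^sub>m n $$ (p, q)) w" for w
  proof -
    have aff: "ncfps_coeff (lin_pencil n C $$ (r, q)) v = 0" if "r < n" "length v > 1" for r v
      using that q by (auto simp: ncfps_coeff_lin_pencil split: list.split)
    have eq: "ncfps_coeff ((word_series n C * lin_pencil n C) $$ (p, q)) w
        = (\<Sum>r<n. ncfps_coeff (word_series n C $$ (p, r) * lin_pencil n C $$ (r, q)) w)"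
      by (simp add: mat_times_index_sum[OF word_series_carrier lin_pencil_carrier p q]
          ncfps_coeff_sum)
    show ?thesis
    proof (cases w rule: rev_exhaust)
      case Nil
      have "ncfps_coeff ((word_series n C * lin_pencil n C) $$ (p, q)) w
          = (\<Sum>r<n. if r = q then word_mat n C [] $$ (p, r) else 0)"
        unfolding eq unfolding Nil using p q
        by (intro sum.cong) (auto simp: ncfps_coeff_mult_affine(1)[OF aff]
            ncfps_coeff_lin_pencil ncfps_coeff_word_series)
      then show ?thesis using p q Nil by (simp add: ncfps_coeff_one)
    next
      case (snoc v x)
      have "ncfps_coeff ((word_series n C * lin_pencil n C) $$ (p, q)) w
          = (\<Sum>r<n. (if r = q then word_mat n C w $$ (p, r) else 0)
              - word_mat n C v $$ (p, r) * C x $$ (r, q))"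
        unfolding eq unfolding snoc using p q
        by (intro sum.cong) (auto simp: ncfps_coeff_mult_affine(2)[OF aff]
            ncfps_coeff_lin_pencil ncfps_coeff_word_series)
      also have "\<dots> = word_mat n C w $$ (p, q) - (word_mat n C v * C x) $$ (p, q)"
        using q by (simp add: sum_subtractf mat_times_index_sum[OF word_mat_carrier[OF C] C p q])
      finally show ?thesis using p q snoc by (simp add: ncfps_coeff_one word_mat_snoc[OF C])
    qed
  qed
  then show "(word_series n C * lin_pencil n C) $$ (p, q) = 1\<^sub>m n $$ (p, q)"
    by (rule ncfps_eqI)
qed (simp_all add: lin_pencil_def word_series_def)

text \<open>Since row and column carry the same number and \<open>insert_index i\<close> is
  injective, the constant term remains an identity matrix. This closure is why
  \<open>lin_pencil\<close> takes arbitrary coefficient matrices: the smaller ones no longer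
  represent the operators of the module.\<close>

lemma mat_delete_lin_pencil:
  fixes C :: "'x::finite \<Rightarrow> 'k::ring_1 mat"
  assumes C: "\<And>x. C x \<in> carrier_mat n n"
  shows "mat_delete (lin_pencil n C) i i = lin_pencil (n - 1) (\<lambda>x. mat_delete (C x) i i)"
    (is "?L = ?R")
proof (rule eq_matI)
  fix k l assume "k < dim_row ?R" "l < dim_col ?R"
  then have k: "k < n - 1" and l: "l < n - 1" by (simp_all add: lin_pencil_def)
  have inj: "insert_index i k = insert_index i l \<longleftrightarrow> k = l"
    by (metis delete_insert_index)
  show "?L $$ (k, l) = ?R $$ (k, l)"
    by (rule ncfps_eqI)
      (simp add: mat_delete_insert_index[OF lin_pencil_carrier k l] mat_delete_insert_index[OF C _ l]
        ncfps_coeff_lin_pencil insert_index_less k l inj del: One_nat_def split: list.split)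
qed (simp_all add: lin_pencil_def)

theorem quasidet_lin_pencil:
  fixes C :: "'x::finite \<Rightarrow> 'k::ring_1 mat"
  assumes C: "\<And>x. C x \<in> carrier_mat n n" and i: "i < n"
  shows "invertible_mat (mat_delete (lin_pencil n C) i i)"
    and "ring_invertible (quasidet (lin_pencil n C) i i)"
    and "ring_inverse (quasidet (lin_pencil n C) i i) = word_series n C $$ (i, i)"
proof -
  let ?C' = "\<lambda>x. mat_delete (C x) i i"
  let ?D = "word_series (n - 1) ?C'"
  have C': "?C' x \<in> carrier_mat (n - 1) (n - 1)" for x
    using mat_delete_carrier[OF C] .
  \<comment> \<open>For \<open>n = 1\<close> these are equations between empty matrices, so no case
    distinction is needed.\<close>
  have inv: "mat_delete (lin_pencil n C) i i * ?D = 1\<^sub>m (n - 1)"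
    "?D * mat_delete (lin_pencil n C) i i = 1\<^sub>m (n - 1)"
    unfolding mat_delete_lin_pencil[OF C]
    by (rule lin_pencil_mult_word_series[OF C'] word_series_mult_lin_pencil[OF C'])+
  show "invertible_mat (mat_delete (lin_pencil n C) i i)"
    by (rule invertible_matI[OF mat_delete_carrier[OF lin_pencil_carrier] word_series_carrier inv])
  note q = quasidet_inverse_entry[OF lin_pencil_carrier word_series_carrier i
      lin_pencil_mult_word_series[OF C] word_series_mult_lin_pencil[OF C] word_series_carrier inv]
  show "ring_invertible (quasidet (lin_pencil n C) i i)"
    unfolding ring_invertible_def using q by blast
  show "ring_inverse (quasidet (lin_pencil n C) i i) = word_series n C $$ (i, i)"
    by (rule ring_inverse_eqI[OF q])
qed

section \<open>Coordinates, traces and matrices of the module operators\<close>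

context free_algebra_module
begin

text \<open>Coordinates are addressed by position in the list rather than by basis vector, to agree
  with matrix indices.\<close>

definition coord :: "'m list \<Rightarrow> 'm \<Rightarrow> nat \<Rightarrow> 'k" where
  "coord bs v j = VS.representation (set bs) v (bs ! j)"

lemma op_matrix_carrier [simp]: "op_matrix bs u \<in> carrier_mat (length bs) (length bs)"
  by (simp add: op_matrix_def)

lemma op_matrix_coord:
  "p < length bs \<Longrightarrow> q < length bs \<Longrightarrow> op_matrix bs u $$ (p, q) = coord bs (u (bs ! p)) q"
  by (simp add: op_matrix_def coord_def)

text \<open>Constants commute with words in the free algebra, so acting by a word commutes with
  \<open>scale\<close>.\<close>

lemma linear_alpha_word:
  "Vector_Spaces.linear scale scale (alpha (ncpoly_word w :: ('x, 'k) ncpoly))"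
proof
  fix u v :: 'm and c :: 'k
  show "alpha (ncpoly_word w) (u + v) = alpha (ncpoly_word w) u + alpha (ncpoly_word w) v"
    by (simp add: alpha_def act_add_left)
  have "ncpoly_const c * ncpoly_word w = (ncpoly_word w * ncpoly_const c :: ('x, 'k) ncpoly)"
    by (simp add: ncpoly_const_def ncpoly_word_def mult_single plus_list_def)
  then show "alpha (ncpoly_word w) (scale c v) = scale c (alpha (ncpoly_word w) v)"
    by (simp add: alpha_def scale_def flip: act_mult)
qed

lemma ordered_basis_expand:
  assumes "ordered_basis bs"
  shows "v = (\<Sum>j<length bs. scale (coord bs v j) (bs ! j))"
proof -
  have "(\<Sum>b\<in>set bs. scale (VS.representation (set bs) v b) b) = v"
    by (rule VS.sum_representation_eq) (use assms in \<open>auto simp: ordered_basis_def\<close>)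
  moreover have "(\<Sum>b\<in>set bs. scale (VS.representation (set bs) v b) b)
      = (\<Sum>j<length bs. scale (coord bs v j) (bs ! j))"
    unfolding coord_def using assms
    by (intro sum.reindex_bij_betw[symmetric] bij_betw_nth) (auto simp: ordered_basis_def)
  ultimately show ?thesis by simp
qed

text \<open>The two bases may differ: with \<open>f\<close> the identity this is a change of basis,
  and with equal bases it yields the matrix of a composition.\<close>

lemma coord_linear_expand:
  assumes "ordered_basis bs" "ordered_basis cs" "Vector_Spaces.linear scale scale f"
  shows "coord cs (f v) k = (\<Sum>j<length bs. coord bs v j * coord cs (f (bs ! j)) k)"
proof -
  interpret f: Vector_Spaces.linear scale scale f by fact
  have ind: "VS.independent (set cs)" and sp: "\<And>v. v \<in> VS.span (set cs)"
    using assms(2) by (auto simp: ordered_basis_def)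
  have "f v = (\<Sum>j<length bs. scale (coord bs v j) (f (bs ! j)))"
    using arg_cong[OF ordered_basis_expand[OF assms(1), of v], of f] by (simp add: f.sum f.scale)
  then show ?thesis
    by (simp add: coord_def VS.representation_sum[OF ind] VS.representation_scale[OF ind] sp)
qed

lemma coord_basis:
  assumes "ordered_basis bs" "i < length bs" "j < length bs"
  shows "coord bs (bs ! i) j = (if i = j then 1 else 0)"
  using assms VS.representation_basis[of "set bs" "bs ! i"]
  by (auto simp: coord_def ordered_basis_def nth_eq_iff_index_eq)

lemma length_ordered_basis:
  assumes "ordered_basis bs"
  shows "length bs = VS.dim UNIV"
  using assms VS.dim_eq_card[of "set bs" UNIV]
  by (auto simp: ordered_basis_def distinct_card)

text \<open>This is tr(PQ) = tr(QP) in coordinates: expand each \<open>cs ! i\<close> in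
  \<open>bs\<close>, exchange the sums, and contract the other way.\<close>

lemma trace_basis_independent:
  assumes bs: "ordered_basis bs" and cs: "ordered_basis cs"
    and u: "Vector_Spaces.linear scale scale u"
  shows "(\<Sum>i<length cs. op_matrix cs u $$ (i, i)) = (\<Sum>i<length bs. op_matrix bs u $$ (i, i))"
proof -
  let ?n = "length bs" and ?m = "length cs"
  have "(\<Sum>i<?m. op_matrix cs u $$ (i, i)) = (\<Sum>i<?m. coord cs (u (cs ! i)) i)"
    by (simp add: op_matrix_coord)
  also have "\<dots> = (\<Sum>i<?m. \<Sum>j<?n. coord bs (cs ! i) j * coord cs (u (bs ! j)) i)"
    by (simp add: coord_linear_expand[OF bs cs u, of "cs ! _"])
  also have "\<dots> = (\<Sum>j<?n. \<Sum>i<?m. coord cs (u (bs ! j)) i * coord bs (cs ! i) j)"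
    by (subst sum.swap) (simp add: mult.commute)
  \<comment> \<open>The inner sum is the change of coordinates of \<open>u (bs ! j)\<close> from
    \<open>cs\<close> to \<open>bs\<close>.\<close>
  also have "\<dots> = (\<Sum>j<?n. coord bs (u (bs ! j)) j)"
    by (simp flip: coord_linear_expand[OF cs bs VS.linear_ident])
  finally show ?thesis by (simp add: op_matrix_coord)
qed

text \<open>The given \<open>bs\<close> witnesses that an ordered basis exists, so the one chosen by
  \<open>SOME\<close> is a basis too and the traces agree.\<close>

lemma op_trace_eq:
  assumes "ordered_basis bs" "Vector_Spaces.linear scale scale u"
  shows "op_trace u = (\<Sum>i<length bs. op_matrix bs u $$ (i, i))"
  unfolding op_trace_def Let_def
  by (rule trace_basis_independent[OF assms(1) someI assms(2)]) (rule assms(1))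

text \<open>Under the right action the first letter acts first, and rows hold the images of basis
  vectors, so its matrix is the leftmost factor, as in \<open>word_mat\<close>.\<close>

lemma op_matrix_alpha_word:
  assumes bs: "ordered_basis bs"
  shows "op_matrix bs (alpha (ncpoly_word w)) = word_mat (length bs) (var_matrix bs) w"
proof (induction w)
  case Nil
  show ?case
    by (rule eq_matI)
      (auto simp: op_matrix_def alpha_def ncpoly_word_Nil act_one
        coord_basis[OF bs, unfolded coord_def])
next
  case (Cons x w)
  let ?n = "length bs"
  let ?a = "\<lambda>w. alpha (ncpoly_word w :: ('x, 'k) ncpoly)"
  have comp: "?a (x # w) v = ?a w (?a [x] v)" for v
    using ncpoly_word_append[of "[x]" w, where 'k = 'k] by (simp add: alpha_def act_mult)
  have "op_matrix bs (?a (x # w)) = op_matrix bs (?a [x]) * op_matrix bs (?a w)"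
  proof (rule eq_matI)
    fix p q
    assume "p < dim_row (op_matrix bs (?a [x]) * op_matrix bs (?a w))"
      "q < dim_col (op_matrix bs (?a [x]) * op_matrix bs (?a w))"
    then have p: "p < ?n" and q: "q < ?n" by (simp_all add: op_matrix_def)
    show "op_matrix bs (?a (x # w)) $$ (p, q) = (op_matrix bs (?a [x]) * op_matrix bs (?a w)) $$ (p, q)"
      using p q
      by (simp add: mat_times_index_sum[OF op_matrix_carrier op_matrix_carrier p q]
          op_matrix_coord comp coord_linear_expand[OF bs bs linear_alpha_word[of w], of "?a [x] _"])
  qed (simp_all add: op_matrix_def)
  then show ?case
    by (simp add: Cons.IH var_matrix_def ncpoly_var_def)
qed

lemma var_matrix_carrier: "var_matrix bs x \<in> carrier_mat (length bs) (length bs)"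
  by (simp add: var_matrix_def)

lemma pencil_eq_lin_pencil: "pencil bs = lin_pencil (length bs) (var_matrix bs)"
  by (simp add: pencil_def lin_pencil_def)

lemma sum_word_series_eq_char_fun:
  assumes bs: "ordered_basis bs"
  shows "(\<Sum>i<length bs. word_series (length bs) (var_matrix bs) $$ (i, i)) = char_fun"
  by (rule ncfps_eqI)
    (simp add: ncfps_coeff_sum ncfps_coeff_word_series char_fun_def
      op_trace_eq[OF bs linear_alpha_word] op_matrix_alpha_word[OF bs])

end

theorem proposition4p2:
  fixes act :: "'m::ab_group_add \<Rightarrow> ('x::finite, 'k::field) ncpoly \<Rightarrow> 'm"
    and bs :: "'m list" and n :: nat
  assumes "free_algebra_module act"
    and "Vector_Spaces.vector_space.dim (free_algebra_module.scale act) (UNIV :: 'm set) = n"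
    and "free_algebra_module.ordered_basis act bs"
  shows "(let A = free_algebra_module.pencil act in
      (\<forall>i<n. invertible_mat (mat_delete (A bs) i i) \<and> ring_invertible (quasidet (A bs) i i)) \<and>
      (\<forall>bs'. free_algebra_module.ordered_basis act bs' \<longrightarrow>
         (\<Sum>i<n. ring_inverse (quasidet (A bs') i i)) =
         (\<Sum>i<n. ring_inverse (quasidet (A bs) i i))) \<and>
      (\<Sum>i<n. ring_inverse (quasidet (A bs) i i)) = free_algebra_module.char_fun act)"
proof -
  interpret free_algebra_module act by fact
  \<comment> \<open>The sums in the statement run up to \<open>n\<close> for every basis; this makes
    them cover exactly the diagonal of each pencil.\<close>
  have len: "length cs = n" if "ordered_basis cs" for cs
    using length_ordered_basis[OF that] assms(2) by simp
  \<comment> \<open>Proved for an arbitrary ordered basis: as \<open>char_fun\<close> involves no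
    given basis, this yields both the value of the sum and its independence of the basis.\<close>
  have char: "(\<Sum>i<n. ring_inverse (quasidet (pencil cs) i i)) = char_fun"
    if "ordered_basis cs" for cs
    using sum_word_series_eq_char_fun[OF that]
    by (simp add: pencil_eq_lin_pencil quasidet_lin_pencil(3)[OF var_matrix_carrier] flip: len[OF that])
  have "invertible_mat (mat_delete (pencil bs) i i) \<and> ring_invertible (quasidet (pencil bs) i i)"
    if "i < n" for i
    using that quasidet_lin_pencil(1,2)[where C = "var_matrix bs", OF var_matrix_carrier] len[OF assms(3)]
    by (simp add: pencil_eq_lin_pencil)
  then show ?thesis
    unfolding Let_def using char assms(3) by simp
qed

end
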